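(* Let $G$ be a finite, simple, undirected, connected graph. Let $c(G)$ denote the cop number of $G$ and let $2\text{-coc}(G)$ denote the $2$-component order connectivity of $G$. Then $$c(G) \leq \frac{2\text{-coc}(G)}{3} + 4.$$
   Context: The game of cops and robber is played on an undirected graph $G$ by a team of cops and one robber, with full information. First the cops place themselves on vertices of $G$, then the robber chooses a vertex. The two sides then alternate turns, starting with the cops. On the cops' turn each cop moves to a neighbouring vertex or stays put. On the robber's turn the robber moves to a neighbouring vertex or stays put. The cops capture the robber when some cop is on the same vertex as the robber, and the game then ends. The robber's goal is to evade capture forever. The cop number $c(G)$ is the minimum number of cops required such that the robber cannot evade the cops indefinitely, i.e. such that the cops have a strategy that captures the robber whatever the robber does. For a positive integer $\ell$, the $\ell$-component order connectivity $\ell\text{-coc}(G)$ of a graph $G=(V,E)$ is the size of a smallest set $U \subseteq V$ such that every connected component of the induced subgraph $G[V\setminus U]$ has at most $\ell$ vertices. *)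

theory Defs
  imports Complex_Main "Graph_Theory.Digraph_Component"
begin

text \<open>
  A finite simple undirected graph is rendered by the locale \<^locale>\<open>graph\<close>: a finite symmetric
  digraph without loops and parallel arcs, where an edge is a pair of opposite arcs. The predicate
  \<^const>\<open>connected\<close> includes that there is at least one vertex. The definitions below are meant for
  such graphs.
\<close>

definition step_or_stay :: "('a, 'b) pre_digraph \<Rightarrow> 'a \<Rightarrow> 'a \<Rightarrow> bool" where
  "step_or_stay G u v \<longleftrightarrow> u \<in> verts G \<and> (v = u \<or> u \<rightarrow>\<^bsub>G\<^esub> v)"

text \<open>
  The function \<open>r\<close> lists the robber's positions: \<open>r 0\<close> is the chosen start vertex and \<open>r n\<close> is
  the position after the robber's \<open>n\<close>-th turn. Plays are continued formally after a capture, which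
  is harmless since everybody may stay put.
\<close>

definition robber_play :: "('a, 'b) pre_digraph \<Rightarrow> (nat \<Rightarrow> 'a) \<Rightarrow> bool" where
  "robber_play G r \<longleftrightarrow> r 0 \<in> verts G \<and> (\<forall>n. step_or_stay G (r n) (r (Suc n)))"

text \<open>
  A strategy of the cops maps the robber's positions so far to the list of positions of the cops
  (several cops may share a vertex). Thus \<open>\<sigma> []\<close> is the initial placement, and
  \<open>\<sigma> [r 0, \<dots>, r (n - 1)]\<close> is the placement after the cops' \<open>n\<close>-th turn. The cops' own past moves
  are determined by \<open>\<sigma>\<close> and the robber's moves, so this is full information.
\<close>

definition cops_at :: "('a list \<Rightarrow> 'a list) \<Rightarrow> (nat \<Rightarrow> 'a) \<Rightarrow> nat \<Rightarrow> 'a list" where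
  "cops_at \<sigma> r n = \<sigma> (map r [0..<n])"

definition cop_strategy :: "('a, 'b) pre_digraph \<Rightarrow> nat \<Rightarrow> ('a list \<Rightarrow> 'a list) \<Rightarrow> bool" where
  "cop_strategy G k \<sigma> \<longleftrightarrow> length (\<sigma> []) = k \<and> set (\<sigma> []) \<subseteq> verts G \<and>
    (\<forall>r. robber_play G r \<longrightarrow>
      (\<forall>n. list_all2 (step_or_stay G) (cops_at \<sigma> r n) (cops_at \<sigma> r (Suc n))))"

text \<open>
  In the order of play, \<open>r n\<close> comes after \<open>cops_at \<sigma> r n\<close> and before \<open>cops_at \<sigma> r (Suc n)\<close>. The
  first disjunct is a robber who enters a cop's vertex, the second a cop who enters the robber's.
\<close>

definition captured :: "('a list \<Rightarrow> 'a list) \<Rightarrow> (nat \<Rightarrow> 'a) \<Rightarrow> bool" where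
  "captured \<sigma> r \<longleftrightarrow>
    (\<exists>n. r n \<in> set (cops_at \<sigma> r n) \<or> r n \<in> set (cops_at \<sigma> r (Suc n)))"

definition cops_win :: "('a, 'b) pre_digraph \<Rightarrow> nat \<Rightarrow> bool" where
  "cops_win G k \<longleftrightarrow>
    (\<exists>\<sigma>. cop_strategy G k \<sigma> \<and> (\<forall>r. robber_play G r \<longrightarrow> captured \<sigma> r))"

definition cop_number :: "('a, 'b) pre_digraph \<Rightarrow> nat" where
  "cop_number G = (LEAST k. cops_win G k)"

definition components :: "('a, 'b) pre_digraph \<Rightarrow> ('a, 'b) pre_digraph set" where
  "components G = {H. pre_digraph.max_subgraph G connected H}"

definition component_order_separator ::
    "nat \<Rightarrow> ('a, 'b) pre_digraph \<Rightarrow> 'a set \<Rightarrow> bool" where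
  "component_order_separator l G U \<longleftrightarrow> U \<subseteq> verts G \<and>
    (\<forall>H \<in> components (G \<restriction> (verts G - U)). card (verts H) \<le> l)"

definition coc :: "nat \<Rightarrow> ('a, 'b) pre_digraph \<Rightarrow> nat" where
  "coc l G = (LEAST m. \<exists>U. component_order_separator l G U \<and> card U = m)"

text \<open>Both minima are attained.\<close>

lemma cops_win_cop_number:
  assumes "graph G"
  shows "cops_win G (cop_number G)"
proof -
  interpret graph G by (rule assms)
  obtain vs where vs: "set vs = verts G"
    using finite_list[OF finite_verts] by blast
  have "list_all2 (step_or_stay G) vs vs"
    using vs by (auto simp: step_or_stay_def list_all2_same)
  then have "cops_win G (length vs)"
    unfolding cops_win_def cop_strategy_def captured_def cops_at_def robber_play_def
    by (intro exI[of _ "\<lambda>_. vs"]) (auto simp: vs)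
  then show ?thesis
    unfolding cop_number_def by (rule LeastI)
qed

lemma component_order_separator_coc:
  assumes "graph G"
  shows "\<exists>U. component_order_separator l G U \<and> card U = coc l G"
proof -
  have "component_order_separator l G (verts G)"
    by (auto simp: component_order_separator_def components_def pre_digraph.max_subgraph_def
        subgraph_def)
  then show ?thesis
    unfolding coc_def by (intro LeastI) blast
qed

end

theory Submission
  imports Defs
begin

text \<open>
  Let \<open>U\<close> be a set of vertices whose removal leaves components with at most two vertices. Cops
  are spent in two ways, and apart from four of them, each disposes of three vertices of \<open>U\<close>.

  \<^emph>\<open>Guards.\<close> One cop can permanently keep the robber out of the closed neighbourhood of a vertex
  (by standing there) or out of a geodesic (by following the robber's projection to it). If such a
  set contains three vertices of \<open>U\<close>, one cop is posted on it, and the others continue in the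
  component of the rest that holds the robber: \<open>guard_reduction\<close>, \<open>star_guard\<close>,
  \<open>geodesic_guard\<close>.

  \<^emph>\<open>Fully dispersed territories.\<close> Suppose that no guard of this kind meets \<open>U\<close> in three
  vertices, and let \<open>W\<close> be the part of \<open>U\<close> in the territory. A geodesic between two vertices of
  \<open>W\<close> then passes through no third one, so its interior lies in one component of the rest and
  its length is at most three. Every closed neighbourhood contains at most two vertices of \<open>W\<close>.
  Consider a robber who leaves \<open>b \<in> W\<close> for a vertex \<open>u\<close> outside \<open>W\<close>. The component of \<open>u\<close> outside
  \<open>W\<close> has at most one other vertex \<open>v\<close>, so there are few ways back to \<open>W\<close>. One is the other
  \<open>W\<close>-neighbour of \<open>u\<close>, reached one move later. At most two more go through \<open>v\<close>; they
  cost the robber one move more, and this is exactly the time in which any cop waiting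
  on \<open>W\<close> can cover them. Hence two cops waiting on \<open>W\<close>, the patrols, close all slow exits. A fast
  exit \<open>w\<close> is closed by a cop who waits at some \<open>h \<in> W\<close> at distance at most two from \<open>w\<close>, and it
  matters that she can wait until the robber's choice of \<open>u\<close> has singled out one such \<open>w\<close>. So one
  cop covers the whole ball of radius two around her home. Homes are chosen greedily, each
  adding three covered vertices; when this stops, every ball of radius two contains at
  most two uncovered vertices. Then the robber is in the end confined to two vertices of
  \<open>W\<close> and the components next to them (\<open>formation_response\<close>, \<open>uncovered_wins\<close>), and the last two
  cops occupy both vertices and drive him out
  (\<open>pair_wins\<close>, \<open>dispersed_wins\<close>).

  The induction over guards is \<open>wins_bound\<close>. It is carried out for a positional description of the
  game (\<open>cop_win\<close>) on vertex sets; \<open>cop_win_strategy\<close> turns it into strategies based on the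
  robber's history.
\<close>

section \<open>The game with closed adjacency\<close>

text \<open>
  Only the relation ``equal or adjacent'' matters for the game, since everybody may stay put. A
  territory is a vertex set \<open>X\<close>, and all moves stay inside it.
\<close>
locale closed_adjacency =
  fixes adj :: "'a \<Rightarrow> 'a \<Rightarrow> bool"
  assumes adj_refl [simp]: "adj u u"
    and adj_sym: "adj u v \<Longrightarrow> adj v u"
begin

definition step :: "'a set \<Rightarrow> 'a \<Rightarrow> 'a \<Rightarrow> bool" where
  "step X u v \<longleftrightarrow> u \<in> X \<and> v \<in> X \<and> adj u v"

text \<open>
  The positions with the cops to move from which they force a capture. As the predicate is a least
  fixed point, plays that go on forever are lost for the cops.
\<close>
inductive cop_win :: "'a set \<Rightarrow> 'a list \<Rightarrow> 'a \<Rightarrow> bool" for X where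
  catch: "list_all2 (step X) cs cs' \<Longrightarrow> r \<in> set cs' \<Longrightarrow> cop_win X cs r"
| move: "list_all2 (step X) cs cs' \<Longrightarrow> (\<And>r'. step X r r' \<Longrightarrow> cop_win X cs' r') \<Longrightarrow> cop_win X cs r"

definition wins_on :: "'a set \<Rightarrow> nat \<Rightarrow> bool" where
  "wins_on X k \<longleftrightarrow> (\<exists>cs. length cs = k \<and> set cs \<subseteq> X \<and> (\<forall>r\<in>X. cop_win X cs r))"

definition walkable :: "'a set \<Rightarrow> bool" where
  "walkable X \<longleftrightarrow> X \<noteq> {} \<and> (\<forall>u\<in>X. \<forall>v\<in>X. (step X)\<^sup>*\<^sup>* u v)"

definition component :: "'a set \<Rightarrow> 'a \<Rightarrow> 'a set" where
  "component X u = {v. (step X)\<^sup>*\<^sup>* u v}"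

lemma step_sym: "step X u v \<Longrightarrow> step X v u"
  by (auto simp: step_def adj_sym)

lemma step_refl: "u \<in> X \<Longrightarrow> step X u u"
  by (simp add: step_def)

lemma steps_stay: "set cs \<subseteq> X \<Longrightarrow> list_all2 (step X) cs cs"
  by (auto simp: list_all2_same step_def)

lemma steps_in: "list_all2 (step X) cs cs' \<Longrightarrow> set cs' \<subseteq> X"
  by (auto simp: list_all2_conv_all_nth step_def in_set_conv_nth)

lemma steps_mono: "X \<subseteq> Y \<Longrightarrow> list_all2 (step X) cs cs' \<Longrightarrow> list_all2 (step Y) cs cs'"
  by (erule list_all2_mono) (auto simp: step_def)

lemma walk_in: "(step X)\<^sup>*\<^sup>* u v \<Longrightarrow> u \<in> X \<Longrightarrow> v \<in> X"
  by (induction rule: rtranclp_induct) (auto simp: step_def)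

lemma walk_sym: "(step X)\<^sup>*\<^sup>* u v \<Longrightarrow> (step X)\<^sup>*\<^sup>* v u"
  by (induction rule: rtranclp_induct) (auto intro: step_sym converse_rtranclp_into_rtranclp)

lemma cop_win_catch:
  assumes "set cs \<subseteq> X" "r \<in> X" "c \<in> set cs" "adj c r"
  shows "cop_win X cs r"
proof -
  obtain as bs where cs: "cs = as @ c # bs"
    using assms(3) by (meson split_list)
  have "list_all2 (step X) cs (as @ r # bs)"
    using assms unfolding cs by (intro list_all2_appendI list.rel_intros steps_stay) (auto simp: step_def)
  then show ?thesis
    by (rule catch) simp
qed

text \<open>
  Lets a team walk to prescribed posts while other cops do their duty. The cops walk one after the
  other, so the distances need not be related.
\<close>
lemma team_walk:
  assumes "walkable X" "length cs = length ts" "set cs \<subseteq> X" "set ts \<subseteq> X"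
  shows "(list_all2 (step X))\<^sup>*\<^sup>* cs ts"
  using assms(2-4)
proof (induction cs ts rule: list_induct2)
  case Nil
  then show ?case by simp
next
  case (Cons c cs t ts)
  have "(step X)\<^sup>*\<^sup>* c t"
    using assms(1) Cons.prems by (auto simp: walkable_def)
  then have "(list_all2 (step X))\<^sup>*\<^sup>* (c # cs) (t # cs)"
    by (induction rule: rtranclp_induct)
      (use Cons.prems in \<open>auto intro!: steps_stay elim!: rtranclp.rtrancl_into_rtrancl\<close>)
  moreover have "(list_all2 (step X))\<^sup>*\<^sup>* cs ts"
    using Cons by simp
  then have "(list_all2 (step X))\<^sup>*\<^sup>* (t # cs) (t # ts)"
    by (induction rule: rtranclp_induct)
      (use Cons.prems step_refl in \<open>auto elim!: rtranclp.rtrancl_into_rtrancl\<close>)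
  ultimately show ?case by simp
qed

lemma component_walkable:
  assumes "u \<in> X"
  shows "walkable (component X u)"
proof -
  let ?Y = "component X u"
  have "(step ?Y)\<^sup>*\<^sup>* u v" if "(step X)\<^sup>*\<^sup>* u v" for v
    using that
  proof (induction rule: rtranclp_induct)
    case (step y z)
    have "(local.step X)\<^sup>*\<^sup>* u z"
      using step.hyps by (rule rtranclp.rtrancl_into_rtrancl)
    then have "y \<in> ?Y" "z \<in> ?Y" "adj y z"
      using step.hyps by (simp_all add: component_def step_def[of X y z])
    then have "local.step ?Y y z"
      by (simp add: step_def)
    then show ?case using step by simp
  qed simp
  then have "(step ?Y)\<^sup>*\<^sup>* v w" if "v \<in> ?Y" "w \<in> ?Y" for v w
    using that walk_sym unfolding component_def by (metis mem_Collect_eq rtranclp_trans)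
  moreover have "u \<in> ?Y"
    by (simp add: component_def)
  ultimately show ?thesis
    by (auto simp: walkable_def)
qed

lemma component_subset: "u \<in> X \<Longrightarrow> component X u \<subseteq> X"
  using walk_in by (auto simp: component_def)

lemma component_closed:
  "u \<in> X \<Longrightarrow> v \<in> component X u \<Longrightarrow> w \<in> X \<Longrightarrow> adj v w \<Longrightarrow> w \<in> component X u"
  by (metis component_def component_subset mem_Collect_eq rtranclp.rtrancl_into_rtrancl step_def subsetD)

text \<open>
  A guard who stands on the image \<open>f x\<close> of the robber's previous position \<open>x\<close> can keep up with the
  robber because \<open>f\<close> maps neighbours to neighbours, and she catches him as soon as he enters
  \<open>S\<close>. So the other cops may play as if \<open>Y\<close>, which can only be left through \<open>S\<close>, were the
  whole board.
\<close>
lemma guard_subgame: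
  assumes "cop_win Y cs r" "r \<in> Y" "Y \<subseteq> X" "set cs \<subseteq> Y"
    and Y: "\<And>y z. y \<in> Y \<Longrightarrow> z \<in> X \<Longrightarrow> adj y z \<Longrightarrow> z \<in> Y \<or> z \<in> S"
    and f: "\<And>x. x \<in> X \<Longrightarrow> f x \<in> X" "\<And>x y. x \<in> X \<Longrightarrow> y \<in> X \<Longrightarrow> adj x y \<Longrightarrow> adj (f x) (f y)"
    and S: "\<And>x s. x \<in> X \<Longrightarrow> s \<in> X \<Longrightarrow> s \<in> S \<Longrightarrow> adj x s \<Longrightarrow> adj (f x) s"
    and x: "x \<in> X" "adj x r"
  shows "cop_win X (f x # cs) r"
  using assms(1,2,4) x
proof (induction arbitrary: x)
  case (catch cs cs' r)
  have "list_all2 (step X) (f x # cs) (f x # cs')"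
    using catch steps_mono[OF \<open>Y \<subseteq> X\<close>] f by (auto intro: step_refl)
  then show ?case
    using catch by (auto intro: cop_win.catch)
next
  case (move cs cs' r)
  have r: "r \<in> X" using move \<open>Y \<subseteq> X\<close> by auto
  have "list_all2 (step X) (f x # cs) (f r # cs')"
    using move r steps_mono[OF \<open>Y \<subseteq> X\<close>] f by (auto simp: step_def)
  then show ?case
  proof (rule cop_win.move)
    fix r' assume r': "step X r r'"
    show "cop_win X (f r # cs') r'"
    proof (cases "r' \<in> Y")
      case True
      then show ?thesis
        using move r' steps_in by (auto simp: step_def)
    next
      case False
      then have "r' \<in> S" using Y move.prems r' by (auto simp: step_def)
      then have "adj (f r) r'" using S r' by (auto simp: step_def)
      moreover have "set cs' \<subseteq> X" using steps_in move.hyps \<open>Y \<subseteq> X\<close> by blast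
      ultimately show ?thesis
        using r' r f by (intro cop_win_catch[of _ _ _ "f r"]) (auto simp: step_def)
    qed
  qed
qed

text \<open>
  The component in which the robber is confined becomes known only when the guard has taken up her
  shadowing; it remains the same while the other cops walk to their opening positions there.
\<close>
lemma guard_established:
  assumes X: "walkable X"
    and f: "\<And>x. x \<in> X \<Longrightarrow> f x \<in> X" "\<And>x y. x \<in> X \<Longrightarrow> y \<in> X \<Longrightarrow> adj x y \<Longrightarrow> adj (f x) (f y)"
    and S: "\<And>x s. x \<in> X \<Longrightarrow> s \<in> X \<Longrightarrow> s \<in> S \<Longrightarrow> adj x s \<Longrightarrow> adj (f x) s"
    and wins: "\<And>r. r \<in> X - S \<Longrightarrow> wins_on (component (X - S) r) m"
    and x: "x \<in> X" "r \<in> X" "adj x r"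
    and cs: "set cs \<subseteq> X" "length cs = m"
  shows "cop_win X (f x # cs) r"
proof (cases "r \<in> S")
  case True
  then show ?thesis
    using S x cs f by (intro cop_win_catch[of _ _ _ "f x"]) auto
next
  case False
  define Y where "Y = component (X - S) r"
  have Y: "Y \<subseteq> X" "Y \<inter> S = {}" "r \<in> Y"
    using component_subset[of r "X - S"] False x(2) by (auto simp: Y_def component_def)
  have out: "z \<in> Y \<or> z \<in> S" if "y \<in> Y" "z \<in> X" "adj y z" for y z
    using component_closed[of r "X - S" y z] that False x(2) by (auto simp: Y_def)
  obtain ts where ts: "length ts = m" "set ts \<subseteq> Y" "\<And>r. r \<in> Y \<Longrightarrow> cop_win Y ts r"
    using wins[of r] False x(2) by (auto simp: Y_def wins_on_def)
  have "(list_all2 (step X))\<^sup>*\<^sup>* cs ts"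
    using team_walk[OF X] cs ts Y by auto
  then show ?thesis
    using \<open>r \<in> Y\<close> x cs
  proof (induction arbitrary: x r rule: converse_rtranclp_induct)
    case base
    show ?case
      by (rule guard_subgame[OF ts(3) _ Y(1) ts(2) out f S]) (use base in auto)
  next
    case (step cs cs')
    have "list_all2 (local.step X) (f x # cs) (f r # cs')"
      using step f by (auto simp: step_def)
    then show ?case
    proof (rule cop_win.move)
      fix r' assume r': "local.step X r r'"
      have cs': "set cs' \<subseteq> X" "length cs' = m"
        using steps_in step.hyps step.prems by (auto dest: list_all2_lengthD)
      show "cop_win X (f r # cs') r'"
      proof (cases "r' \<in> Y")
        case True
        then show ?thesis
          using step.IH[of r' r] step.prems cs' r' by (auto simp: step_def)
      next
        case False
        then have "r' \<in> S" using out step.prems r' by (auto simp: step_def)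
        then have "adj (f r) r'" using S r' by (auto simp: step_def)
        then show ?thesis
          using r' f cs' by (intro cop_win_catch[of _ _ _ "f r"]) (auto simp: step_def)
      qed
    qed
  qed
qed

text \<open>
  The robber's shadow moves on the walk \<open>p\<close>; its index \<open>g\<close> changes by at most one per move. A cop
  who starts at \<open>p 0\<close> and walks up therefore cannot be passed by the shadow without meeting it,
  and she meets it because the walk is finite. With \<open>n = 0\<close> the guard just stands at \<open>p 0\<close>.
\<close>
lemma guard_reduction:
  fixes g :: "'a \<Rightarrow> nat"
  assumes X: "walkable X"
    and p: "\<And>i. i \<le> n \<Longrightarrow> p i \<in> X" "\<And>i. i < n \<Longrightarrow> adj (p i) (p (Suc i))"
    and g: "\<And>x. x \<in> X \<Longrightarrow> g x \<le> n" "\<And>x y. x \<in> X \<Longrightarrow> y \<in> X \<Longrightarrow> adj x y \<Longrightarrow> g y \<le> Suc (g x)"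
    and S: "\<And>x s. x \<in> X \<Longrightarrow> s \<in> X \<Longrightarrow> s \<in> S \<Longrightarrow> adj x s \<Longrightarrow> adj (p (g x)) s"
    and wins: "\<And>r. r \<in> X - S \<Longrightarrow> wins_on (component (X - S) r) m"
  shows "wins_on X (Suc m)"
proof -
  have f: "p (g x) \<in> X" if "x \<in> X" for x
    using that p g by auto
  have f2: "adj (p (g x)) (p (g y))" if xy: "x \<in> X" "y \<in> X" "adj x y" for x y
  proof -
    have "g y \<le> Suc (g x)" "g x \<le> Suc (g y)" "g x \<le> n" "g y \<le> n"
      using g xy adj_sym by auto
    then consider "g x = g y" | "g y = Suc (g x)" "g x < n" | "g x = Suc (g y)" "g y < n"
      by linarith
    then show ?thesis
      using p adj_sym by cases auto
  qed
  have est: "cop_win X (p (g x) # cs) r"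
    if "x \<in> X" "r \<in> X" "adj x r" "set cs \<subseteq> X" "length cs = m" for x r cs
    using guard_established[where f = "\<lambda>x. p (g x)", OF X f f2 S wins that] .
  have approach: "cop_win X (p a # cs) r"
    if "a \<le> g r" "r \<in> X" "set cs \<subseteq> X" "length cs = m" for a r cs
    using that(1,2)
  proof (induction "n - a" arbitrary: a r rule: less_induct)
    case less
    show ?case
    proof (cases "a = g r")
      case True
      then show ?thesis using est[of r r] less that by simp
    next
      case False
      then have a: "a < n" "Suc a \<le> g r" using less g[of r] by auto
      have "list_all2 (step X) (p a # cs) (p (Suc a) # cs)"
        using p a that by (auto simp: step_def intro!: steps_stay)
      then show ?thesis
      proof (rule cop_win.move)
        fix r' assume r': "step X r r'"
        show "cop_win X (p (Suc a) # cs) r'"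
        proof (cases "Suc a = g r")
          case True
          then show ?thesis
            using est[of r r'] r' that by (simp add: step_def)
        next
          case False
          then have "Suc a \<le> g r'"
            using a g(2)[of r' r] r' adj_sym by (force simp: step_def)
          then show ?thesis
            using less(1)[of "Suc a" r'] a r' by (auto simp: step_def)
        qed
      qed
    qed
  qed
  have "cop_win X (p 0 # replicate m (p 0)) r" if "r \<in> X" for r
    by (rule approach) (use that p(1)[of 0] in auto)
  then show ?thesis
    unfolding wins_on_def using p(1)[of 0]
    by (intro exI[of _ "p 0 # replicate m (p 0)"]) auto
qed

end

section \<open>Territories where the separator is sparse\<close>

context closed_adjacency
begin

definition within2 :: "'a set \<Rightarrow> 'a \<Rightarrow> 'a \<Rightarrow> bool" where
  "within2 X u v \<longleftrightarrow> (\<exists>y\<in>X. adj u y \<and> adj y v)"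

lemma within2_sym: "within2 X u v \<Longrightarrow> within2 X v u"
  unfolding within2_def by (meson adj_sym)

lemma adj_within2: "u \<in> X \<Longrightarrow> adj u v \<Longrightarrow> within2 X u v"
  unfolding within2_def by (meson adj_refl)

end

lemma card_le_2_pair:
  assumes "finite B" "card B \<le> 2" "b \<in> B"
  obtains b' where "b' \<in> B" "B = {b, b'}"
proof -
  have "card (B - {b}) \<le> Suc 0"
    using assms by simp
  then obtain c where "B - {b} \<subseteq> {c}"
    using assms(1) by (metis card_le_Suc0_iff_eq finite_Diff subsetI singleton_iff)
  then have "B = {b, b} \<or> c \<in> B \<and> B = {b, c}"
    using assms(3) by blast
  then show ?thesis
    using that assms(3) by blast
qed

lemma card_le_2_cover:
  assumes "finite B" "card B \<le> 2" "B \<subseteq> W" "w \<in> W"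
  obtains e1 e2 where "e1 \<in> W" "e2 \<in> W" "B \<subseteq> {e1, e2}"
proof (cases "B = {}")
  case True
  then show ?thesis using that assms by blast
next
  case False
  then obtain b where "b \<in> B" by blast
  then obtain b' where "b' \<in> B" "B = {b, b'}"
    using card_le_2_pair assms(1,2) by metis
  then show ?thesis using that assms(3) by blast
qed

text \<open>
  The situation in which guards no longer help. Outside \<open>W\<close> the components have at most two
  vertices, which is expressed by the absence of paths with three vertices. The list of homes may
  have repetitions, so that its length can be prescribed.
\<close>
locale dispersed_territory = closed_adjacency adj
  for adj :: "'a \<Rightarrow> 'a \<Rightarrow> bool" +
  fixes X W :: "'a set" and homes :: "'a list"
  assumes X_walkable: "walkable X"
    and W_subset: "W \<subseteq> X"
    and W_finite: "finite W"
    and few_neighbours: "v \<in> X \<Longrightarrow> card {w \<in> W. adj v w} \<le> 2"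
    and outside_small: "a \<in> X - W \<Longrightarrow> b \<in> X - W \<Longrightarrow> c \<in> X - W \<Longrightarrow> adj a b \<Longrightarrow> adj b c \<Longrightarrow>
      a = b \<or> b = c \<or> a = c"
    and W_diameter: "v \<in> W \<Longrightarrow> w \<in> W \<Longrightarrow> \<exists>y\<in>X. adj v y \<and> within2 X y w"
    and within2_neighbour: "u \<in> W \<Longrightarrow> v \<in> W \<Longrightarrow> w \<in> W \<Longrightarrow> within2 X u v \<Longrightarrow> adj v w \<Longrightarrow> within2 X u w"
    and homes_subset: "set homes \<subseteq> W"
    and few_uncovered:
      "v \<in> W \<Longrightarrow> card {w \<in> W. within2 X v w \<and> (\<forall>h\<in>set homes. \<not> within2 X h w)} \<le> 2"
begin

definition covered :: "'a set" where
  "covered = {w \<in> W. \<exists>h\<in>set homes. within2 X h w}"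

text \<open>
  A patrol at \<open>y\<close>, assigned to the slow exit \<open>e\<close>, while the robber is at \<open>x\<close> after having left \<open>W\<close>
  through \<open>u\<close>. She can be one move behind only as long as the robber is still at \<open>u\<close>, from where \<open>e\<close>
  is two moves away for him. She can always step back to \<open>W\<close>, so that she is ready again when the
  robber returns.
\<close>
definition patrol :: "'a \<Rightarrow> 'a \<Rightarrow> 'a \<Rightarrow> 'a \<Rightarrow> bool" where
  "patrol u x y e \<longleftrightarrow> y \<in> X \<and> e \<in> W \<and> (\<exists>p\<in>W. adj y p) \<and> (adj y e \<or> x = u \<and> within2 X y e)"

text \<open>
  The robber has left \<open>b\<close> through \<open>u\<close> and is now at \<open>x\<close>, in the component of \<open>u\<close> outside \<open>W\<close>. The
  cop with home \<open>h\<close> stands at \<open>\<phi> h\<close>. Covered fast exits are threatened by one of these cops, and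
  the exits that are not neighbours of \<open>u\<close> are among \<open>e1\<close> and \<open>e2\<close>.
\<close>
definition sortie ::
    "'a \<Rightarrow> 'a \<Rightarrow> 'a \<Rightarrow> ('a \<Rightarrow> 'a) \<Rightarrow> 'a \<Rightarrow> 'a \<Rightarrow> 'a \<Rightarrow> 'a \<Rightarrow> bool" where
  "sortie b u x \<phi> y1 y2 e1 e2 \<longleftrightarrow>
    b \<in> W \<and> u \<in> X - W \<and> x \<in> X - W \<and> adj u b \<and> adj u x \<and>
    (\<forall>h\<in>set homes. step X h (\<phi> h)) \<and>
    (\<forall>w\<in>covered. adj u w \<longrightarrow> w \<noteq> b \<longrightarrow> (\<exists>h\<in>set homes. adj (\<phi> h) w)) \<and>
    (\<forall>z\<in>X - W. adj u z \<longrightarrow> (\<forall>w\<in>W. adj z w \<longrightarrow> adj u w \<or> w = e1 \<or> w = e2)) \<and>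
    patrol u x y1 e1 \<and> patrol u x y2 e2"

text \<open>
  The invariant after each turn of the cops. The base \<open>b\<close> is the vertex of \<open>W\<close> that the robber
  visited last.
\<close>
definition formation :: "'a \<Rightarrow> 'a list \<Rightarrow> 'a \<Rightarrow> bool" where
  "formation b T x \<longleftrightarrow>
    b \<in> W \<and> x = b \<and> (\<exists>p\<in>W. \<exists>q\<in>W. T = homes @ [p, q]) \<or>
    (\<exists>u \<phi> y1 y2 e1 e2. sortie b u x \<phi> y1 y2 e1 e2 \<and> T = map \<phi> homes @ [y1, y2])"

text \<open>
  How the base can change without a capture: not at all, along an edge inside \<open>W\<close>, or through a
  common neighbour to an uncovered vertex.
\<close>
definition allowed :: "'a \<Rightarrow> 'a \<Rightarrow> bool" where
  "allowed b b' \<longleftrightarrow> adj b b' \<or> within2 X b b' \<and> b' \<notin> covered"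

lemma homes_in: "h \<in> set homes \<Longrightarrow> h \<in> X"
  using homes_subset W_subset by blast

lemma formation_in:
  assumes "formation b T x"
  shows "set T \<subseteq> X" "x \<in> X" "b \<in> W"
  using assms homes_in W_subset
  by (auto simp: formation_def sortie_def patrol_def step_def)

text \<open>
  Besides \<open>u\<close> the component has at most one vertex, and this vertex has at most two neighbours
  in \<open>W\<close>.
\<close>
lemma exits:
  assumes "u \<in> X - W" "b \<in> W"
  obtains e1 e2 where "e1 \<in> W" "e2 \<in> W"
    "\<forall>z\<in>X - W. adj u z \<longrightarrow> (\<forall>w\<in>W. adj z w \<longrightarrow> adj u w \<or> w = e1 \<or> w = e2)"
proof (cases "\<exists>v\<in>X - W. adj u v \<and> v \<noteq> u")
  case True
  then obtain v where v: "v \<in> X - W" "adj u v" "v \<noteq> u" by blast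
  have "{w \<in> W. adj v w} \<subseteq> W" by blast
  then obtain e1 e2 where e: "e1 \<in> W" "e2 \<in> W" "{w \<in> W. adj v w} \<subseteq> {e1, e2}"
    using card_le_2_cover[of "{w \<in> W. adj v w}" W b] few_neighbours[of v] v W_finite assms by auto
  have "z = u \<or> z = v" if "z \<in> X - W" "adj u z" for z
    using outside_small[of z u v] that v assms adj_sym by blast
  then show ?thesis using that e by blast
next
  case False
  then show ?thesis using that[of b b] assms by blast
qed

lemma patrol_start:
  assumes "p \<in> W" "e \<in> W"
  obtains y where "step X p y" "patrol u u y e"
proof -
  obtain y where "y \<in> X" "adj p y" "within2 X y e"
    using W_diameter assms by blast
  moreover from this have "\<exists>w\<in>W. adj y w"
    using assms adj_sym by blast
  ultimately show ?thesis
    using that assms W_subset by (auto simp: patrol_def step_def)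
qed

lemma patrol_continue:
  assumes "patrol u x y e"
  obtains y' where "step X y y'" "patrol u x' y' e"
proof -
  have y: "y \<in> X" "e \<in> W" "\<exists>p\<in>W. adj y p" and near: "adj y e \<or> within2 X y e"
    using assms by (auto simp: patrol_def)
  obtain z where "z \<in> X" "adj y z" "adj z e"
    using near y(1) adj_refl unfolding within2_def by blast
  then show ?thesis
    using that[of z] y by (auto simp: patrol_def step_def)
qed

text \<open>
  Both the fast exit \<open>w1\<close> and the slow exits are determined as soon as the robber steps on \<open>x'\<close>, so
  at most one cop has to leave her home, and she has to move only once.
\<close>
lemma formation_leave:
  assumes b: "b \<in> W" and T: "p \<in> W" "q \<in> W" and x': "x' \<in> X - W" "adj b x'"
  shows "\<exists>T'. list_all2 (step X) (homes @ [p, q]) T' \<and> formation b T' x'"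
proof -
  obtain e1 e2 where e: "e1 \<in> W" "e2 \<in> W"
    "\<forall>z\<in>X - W. adj x' z \<longrightarrow> (\<forall>w\<in>W. adj z w \<longrightarrow> adj x' w \<or> w = e1 \<or> w = e2)"
    by (rule exits[OF x'(1) b])
  obtain y1 where y1: "step X p y1" "patrol x' x' y1 e1" using patrol_start[OF T(1) e(1)] by blast
  obtain y2 where y2: "step X q y2" "patrol x' x' y2 e2" using patrol_start[OF T(2) e(2)] by blast
  have "b \<in> {w \<in> W. adj x' w}" using b x' adj_sym by blast
  then obtain w1 where w1: "{w \<in> W. adj x' w} = {b, w1}"
    using card_le_2_pair[of "{w \<in> W. adj x' w}" b] few_neighbours[of x'] x' W_finite by auto
  have "\<exists>\<phi>. (\<forall>h\<in>set homes. step X h (\<phi> h)) \<and> (w1 \<in> covered \<longrightarrow> (\<exists>h\<in>set homes. adj (\<phi> h) w1))"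
  proof (cases "w1 \<in> covered")
    case True
    then obtain h y where "h \<in> set homes" "y \<in> X" "adj h y" "adj y w1"
      by (auto simp: covered_def within2_def)
    then show ?thesis
      using homes_in by (intro exI[of _ "id(h := y)"]) (auto simp: step_def)
  next
    case False
    then show ?thesis
      using homes_in by (intro exI[of _ id]) (auto simp: step_def)
  qed
  then obtain \<phi> where \<phi>: "\<forall>h\<in>set homes. step X h (\<phi> h)"
    "w1 \<in> covered \<Longrightarrow> \<exists>h\<in>set homes. adj (\<phi> h) w1"
    by blast
  have "\<forall>w\<in>covered. adj x' w \<longrightarrow> w \<noteq> b \<longrightarrow> (\<exists>h\<in>set homes. adj (\<phi> h) w)"
    using w1 \<phi>(2) by (auto simp: covered_def)
  moreover have "adj x' b" using x' adj_sym by blast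
  ultimately have "sortie b x' x' \<phi> y1 y2 e1 e2"
    using b x' \<phi>(1) y1 y2 e(3) by (simp add: sortie_def)
  then have "formation b (map \<phi> homes @ [y1, y2]) x'"
    unfolding formation_def by blast
  moreover have "list_all2 (step X) (homes @ [p, q]) (map \<phi> homes @ [y1, y2])"
    using \<phi>(1) y1 y2 by (intro list_all2_appendI) (auto simp: list_all2_map2 list_all2_same)
  ultimately show ?thesis by blast
qed

text \<open>
  The team, consisting of the cops with homes and the two patrols, maintains its formation against
  every move of the robber or catches him. When the robber is back on \<open>W\<close>, every cop is within one
  step of her home, or of some vertex of \<open>W\<close> if she is a patrol.
\<close>
lemma formation_response:
  assumes T: "formation b T x" and x': "step X x x'"
  shows "(\<exists>c\<in>set T. adj c x') \<or>
    (\<exists>T' b'. list_all2 (step X) T T' \<and> formation b' T' x' \<and> allowed b b')"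
proof (cases "x = b")
  case True
  then obtain p q where pq: "b \<in> W" "p \<in> W" "q \<in> W" "T = homes @ [p, q]"
    using T by (auto simp: formation_def sortie_def)
  show ?thesis
  proof (cases "x' \<in> W")
    case x'W: True
    have "formation x' T x'" using x'W pq by (auto simp: formation_def)
    moreover have "list_all2 (step X) T T"
      using formation_in(1)[OF T] by (intro steps_stay) auto
    moreover have "allowed b x'" using x' True by (auto simp: allowed_def step_def)
    ultimately show ?thesis by blast
  next
    case False
    then have "x' \<in> X - W" "adj b x'" using x' True by (auto simp: step_def)
    moreover have "allowed b b" by (simp add: allowed_def)
    ultimately show ?thesis using formation_leave pq by metis
  qed
next
  case False
  then obtain u \<phi> y1 y2 e1 e2 where
    sortie: "sortie b u x \<phi> y1 y2 e1 e2" and f: "T = map \<phi> homes @ [y1, y2]"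
    using T unfolding formation_def by blast
  from sortie have u: "u \<in> X - W" "adj u b" "adj u x" and x: "x \<in> X - W"
    and \<phi>: "\<forall>h\<in>set homes. step X h (\<phi> h)"
    and fast: "\<forall>w\<in>covered. adj u w \<longrightarrow> w \<noteq> b \<longrightarrow> (\<exists>h\<in>set homes. adj (\<phi> h) w)"
    and slow: "\<forall>z\<in>X - W. adj u z \<longrightarrow> (\<forall>w\<in>W. adj z w \<longrightarrow> adj u w \<or> w = e1 \<or> w = e2)"
    and patrol: "patrol u x y1 e1" "patrol u x y2 e2"
    by (simp_all add: sortie_def)
  show ?thesis
  proof (cases "x' \<in> W")
    case x'W: True
    show ?thesis
    proof (cases "adj u x'")
      case True
      show ?thesis
      proof (cases "x' = b \<or> x' \<notin> covered")
        case home: True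
        obtain p q where pq: "p \<in> W" "adj y1 p" "q \<in> W" "adj y2 q" "y1 \<in> X" "y2 \<in> X"
          using patrol by (auto simp: patrol_def)
        have "list_all2 (step X) (map \<phi> homes) homes"
          using \<phi> by (auto simp: list_all2_map1 list_all2_same intro: step_sym)
        then have "list_all2 (step X) T (homes @ [p, q])"
          using pq W_subset unfolding f by (auto simp: step_def intro!: list_all2_appendI)
        moreover have "formation x' (homes @ [p, q]) x'"
          using x'W pq by (auto simp: formation_def)
        moreover have "within2 X b x'"
          using u True adj_sym unfolding within2_def by blast
        then have "allowed b x'"
          using home by (auto simp: allowed_def)
        ultimately show ?thesis by blast
      next
        case False
        then show ?thesis using f fast True by auto
      qed
    next
      case False
      then have "x \<noteq> u" "x' = e1 \<or> x' = e2"
        using u slow x x' x'W unfolding step_def by blast+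
      then show ?thesis
        using f patrol by (auto simp: patrol_def)
    qed
  next
    case out: False
    then have "adj u x'"
      using outside_small[of u x x'] adj_refl[of u] x x' u out unfolding step_def by blast
    obtain z1 where z1: "step X y1 z1" "patrol u x' z1 e1" by (rule patrol_continue[OF patrol(1)])
    obtain z2 where z2: "step X y2 z2" "patrol u x' z2 e2" by (rule patrol_continue[OF patrol(2)])
    have "\<phi> h \<in> X" if "h \<in> set homes" for h
      using \<phi> that by (auto simp: step_def)
    then have "list_all2 (step X) T (map \<phi> homes @ [z1, z2])"
      unfolding f using z1 z2 by (intro list_all2_appendI steps_stay) auto
    moreover have "sortie b u x' \<phi> z1 z2 e1 e2"
      using sortie \<open>adj u x'\<close> x' out z1 z2 by (simp add: sortie_def step_def)
    then have "formation b (map \<phi> homes @ [z1, z2]) x'"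
      unfolding formation_def by blast
    moreover have "allowed b b" by (simp add: allowed_def)
    ultimately show ?thesis by blast
  qed
qed

text \<open>
  The formation together with two free cops \<open>hs\<close> in arbitrary positions wins once the base is \<open>b\<close>.
\<close>
definition wins_from :: "'a \<Rightarrow> bool" where
  "wins_from b \<longleftrightarrow> (\<forall>T x r hs. formation b T x \<longrightarrow> step X x r \<longrightarrow> length hs = 2 \<longrightarrow> set hs \<subseteq> X \<longrightarrow>
    cop_win X (T @ hs) r)"

lemma formation_round:
  assumes "formation b T x" "step X x r" "list_all2 (step X) hs hs'"
    and next_round: "\<And>T' b' r'. formation b' T' r \<Longrightarrow> allowed b b' \<Longrightarrow> step X r r' \<Longrightarrow>
      cop_win X (T' @ hs') r'"
  shows "cop_win X (T @ hs) r"
proof (cases "\<exists>c\<in>set T. adj c r")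
  case True
  moreover have "set hs \<subseteq> X"
    using assms(3) by (auto simp: list_all2_conv_all_nth step_def in_set_conv_nth)
  ultimately show ?thesis
    using cop_win_catch[of "T @ hs" X r] formation_in(1)[OF assms(1)] assms(2)
    by (auto simp: step_def)
next
  case False
  then obtain T' b' where "list_all2 (step X) T T'" "formation b' T' r" "allowed b b'"
    using formation_response[OF assms(1,2)] by blast
  then show ?thesis
    using assms(3) next_round by (intro move[of X "T @ hs" "T' @ hs'"] list_all2_appendI)
qed

text \<open>
  If the base can leave \<open>{a, b}\<close> only for vertices from which the cops win, the free cops walk to \<open>a\<close>
  and \<open>b\<close>. Unless he is caught, the robber is then outside \<open>W\<close>, on or next to a neighbour \<open>u\<close> of his
  base, and the free cop on this base attacks by stepping on \<open>u\<close>. A robber who survives this must run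
  back to \<open>W\<close> at once. The base is still adjacent to \<open>u\<close>, the other free cop stands on the
  other vertex of the pair, and any other exit is left to the formation.
\<close>
lemma pair_wins:
  assumes ab: "a \<in> W" "b \<in> W"
    and step_out: "\<And>c c'. c \<in> {a, b} \<Longrightarrow> c' \<in> W \<Longrightarrow> allowed c c' \<Longrightarrow> c' \<in> {a, b} \<or> wins_from c'"
    and c: "c \<in> {a, b}"
  shows "wins_from c"
proof -
  have wins_fromD: "cop_win X (T @ hs) r"
    if "wins_from d" "formation d T x" "step X x r" "length hs = 2" "set hs \<subseteq> X" for d T x r hs
    using that by (auto simp: wins_from_def)
  have inX: "a \<in> X" "b \<in> X" using ab W_subset by auto
  have settled: "cop_win X (T @ [a, b]) r" if T: "formation d T x" "d \<in> {a, b}" "step X x r" for T x r d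
  proof (cases "\<exists>c\<in>set T. adj c r")
    case True
    then show ?thesis
      using cop_win_catch[of "T @ [a, b]" X r] formation_in(1)[OF T(1)] T(3) inX
      by (auto simp: step_def)
  next
    case False
    then obtain T' c where move_T: "list_all2 (step X) T T'" and T': "formation c T' r" "allowed d c"
      using formation_response[OF T(1,3)] by blast
    have cW: "c \<in> W" using formation_in[OF T'(1)] by simp
    have TX: "set T \<subseteq> X" "set T' \<subseteq> X" "r \<in> X"
      using formation_in T(1) T'(1) by auto
    consider "c \<notin> {a, b}" | "c \<in> {a, b}" "r = c" | "c \<in> {a, b}" "r \<noteq> c" by blast
    then show ?thesis
    proof cases
      case 1
      then have "wins_from c" using step_out[OF T(2) cW T'(2)] by blast
      then show ?thesis
        using wins_fromD T'(1) inX move_T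
        by (intro move[of X "T @ [a, b]" "T' @ [a, b]"] list_all2_appendI steps_stay) auto
    next
      case 2
      then show ?thesis
        using cop_win_catch[of "T @ [a, b]" X r c] TX inX by auto
    next
      case 3
      then obtain u where u: "u \<in> X - W" "adj u c" "adj u r" and r: "r \<in> X - W"
        using T'(1) unfolding formation_def sortie_def by blast
      define other where "other = (if c = a then b else a)"
      \<comment> \<open>The free cop on the base \<open>c\<close> steps on \<open>u\<close>.\<close>
      define hs where "hs = (if c = a then [u, b] else [a, u])"
      have hs: "set hs = {u, other}" "{a, b} = {c, other}"
        using 3(1) by (auto simp: hs_def other_def)
      have "list_all2 (step X) [a, b] hs"
        using u inX 3(1) by (auto simp: hs_def step_def intro: adj_sym)
      then have "list_all2 (step X) (T @ [a, b]) (T' @ hs)"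
        using move_T by (rule list_all2_appendI[rotated])
      then show ?thesis
      proof (rule move)
        fix r' assume r': "step X r r'"
        have hsX: "set hs \<subseteq> X" "length hs = 2"
          using hs inX u by (auto simp: hs_def other_def)
        show "cop_win X (T' @ hs) r'"
        proof (cases "adj u r' \<or> r' = other")
          case True
          then show ?thesis
            using cop_win_catch[of "T' @ hs" X r' u] cop_win_catch[of "T' @ hs" X r' other] hs hsX TX r'
            by (auto simp: step_def)
        next
          case False
          then have "r' \<noteq> c" using u(2) by blast
          then have "r' \<notin> {a, b}" using hs(2) False by blast
          have "r' \<in> W"
            using outside_small[of u r r'] adj_refl[of u] u r r' False unfolding step_def by blast
          show ?thesis
          proof (rule formation_round[OF T'(1) r' steps_stay[OF hsX(1)]])
            fix T'' c' r'' assume T'': "formation c' T'' r'" "allowed c c'" "step X r' r''"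
            have "c' = r'"
              using T''(1) \<open>r' \<in> W\<close> by (auto simp: formation_def sortie_def)
            then have "wins_from c'"
              using step_out[OF 3(1) _ T''(2)] \<open>r' \<in> W\<close> \<open>r' \<notin> {a, b}\<close> by blast
            then show "cop_win X (T'' @ hs) r''"
              using wins_fromD T'' hsX by blast
          qed
        qed
      qed
    qed
  qed
  have "cop_win X (T @ hs) r"
    if "formation d T x" "d \<in> {a, b}" "step X x r" "length hs = 2" "set hs \<subseteq> X" for T x r hs d
  proof -
    have "(list_all2 (step X))\<^sup>*\<^sup>* hs [a, b]"
      using that inX by (intro team_walk[OF X_walkable]) auto
    then show ?thesis
      using that
    proof (induction arbitrary: T x r d rule: converse_rtranclp_induct)
      case base
      then show ?case using settled by blast
    next
      case (step hs hs')
      show ?case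
      proof (rule formation_round[OF step.prems(1,3) step.hyps(1)])
        fix T' c r'
        assume T': "formation c T' r" "allowed d c" and r': "local.step X r r'"
        have hs': "length hs' = 2" "set hs' \<subseteq> X"
          using steps_in[OF step.hyps(1)] list_all2_lengthD[OF step.hyps(1)] step.prems by auto
        show "cop_win X (T' @ hs') r'"
        proof (cases "c \<in> {a, b}")
          case True
          then show ?thesis using step.IH T' r' hs' by blast
        next
          case False
          then have "wins_from c"
            using step_out[OF step.prems(2) _ T'(2)] formation_in(3)[OF T'(1)] by blast
          then show ?thesis using wins_fromD T'(1) r' hs' by blast
        qed
      qed
    qed
  qed
  then show ?thesis using c unfolding wins_from_def by blast
qed

text \<open>
  The uncovered vertices within distance two of \<open>b\<close> are \<open>b\<close> itself and at most one vertex \<open>b'\<close>, whose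
  uncovered surroundings are again \<open>{b, b'}\<close>. Adjacent vertices of \<open>W\<close> are either both covered or
  both uncovered by \<open>within2_neighbour\<close>, so the base never leaves this pair.
\<close>
lemma uncovered_wins:
  assumes b: "b \<in> W" "b \<notin> covered"
  shows "wins_from b"
proof -
  define ball where "ball v = {w \<in> W. within2 X v w \<and> (\<forall>h\<in>set homes. \<not> within2 X h w)}" for v
  have ball_iff: "w \<in> ball v \<longleftrightarrow> w \<in> W \<and> within2 X v w \<and> w \<notin> covered" for v w
    by (auto simp: ball_def covered_def)
  have ball: "finite (ball v)" "v \<in> W \<Longrightarrow> card (ball v) \<le> 2" for v
    using W_finite few_uncovered by (auto simp: ball_def)
  have self: "v \<in> ball v" if "v \<in> W" "v \<notin> covered" for v
    using that W_subset by (auto simp: ball_iff intro: adj_within2)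
  obtain b' where b': "b' \<in> ball b" "ball b = {b, b'}"
    using card_le_2_pair[OF ball(1) ball(2)[OF b(1)] self[OF b]] by blast
  have ball': "ball b' = {b, b'}"
  proof -
    have b'W: "b' \<in> W" "b' \<notin> covered" "within2 X b b'"
      using b'(1) unfolding ball_iff by auto
    have "b \<in> ball b'"
      unfolding ball_iff using b within2_sym[OF b'W(3)] by simp
    then have "{b, b'} \<subseteq> ball b'"
      using self[OF b'W(1,2)] by simp
    moreover have "card (ball b') \<le> card {b, b'}"
    proof (cases "b = b'")
      case True
      then show ?thesis using b'(2) by simp
    next
      case False
      then show ?thesis using ball(2)[OF b'W(1)] by simp
    qed
    ultimately show ?thesis
      using ball(1) card_seteq by metis
  qed
  show ?thesis
  proof (rule pair_wins[of b b'])
    fix c c' assume c: "c \<in> {b, b'}" "c' \<in> W" "allowed c c'"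
    have cW: "c \<in> W" "c \<notin> covered" "ball c = {b, b'}"
      using c(1) b b' ball' by (auto simp: ball_iff)
    have "c' \<notin> covered"
    proof
      assume "c' \<in> covered"
      then obtain h where h: "h \<in> set homes" "within2 X h c'" by (auto simp: covered_def)
      have "adj c' c" using c(3) \<open>c' \<in> covered\<close> adj_sym by (auto simp: allowed_def)
      then have "within2 X h c"
        using within2_neighbour h homes_subset c(2) cW(1) by blast
      then show False using cW h(1) by (auto simp: covered_def)
    qed
    moreover have "within2 X c c'"
      using c(3) cW(1) W_subset by (auto simp: allowed_def intro: adj_within2)
    ultimately have "c' \<in> ball c" using c(2) by (simp add: ball_iff)
    then show "c' \<in> {b, b'} \<or> wins_from c'" using cW(3) by simp
  qed (use b b' in \<open>auto simp: ball_iff\<close>)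
qed

text \<open>
  A vertex of \<open>W\<close> has at most one proper neighbour in \<open>W\<close>. Every change of base other than between
  these two leads to an uncovered vertex, where the robber loses by \<open>uncovered_wins\<close>.
\<close>
lemma all_bases_win:
  assumes b: "b \<in> W"
  shows "wins_from b"
proof -
  define N where "N v = {w \<in> W. adj v w}" for v
  have N: "finite (N v)" "v \<in> W \<Longrightarrow> card (N v) \<le> 2" "v \<in> W \<Longrightarrow> v \<in> N v" for v
    using W_finite few_neighbours W_subset by (auto simp: N_def)
  obtain m where m: "m \<in> N b" "N b = {b, m}"
    using card_le_2_pair[OF N(1) N(2)[OF b] N(3)[OF b]] by blast
  have mW: "m \<in> W" "adj m b" using m adj_sym by (auto simp: N_def)
  have "N m = {b, m}"
  proof (cases "b = m")
    case False
    have "{b, m} \<subseteq> N m" using b mW by (simp add: N_def)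
    moreover have "card (N m) \<le> card {b, m}" using N(2)[OF mW(1)] False by simp
    ultimately show ?thesis using N(1) card_seteq by metis
  qed (use m in simp)
  show ?thesis
  proof (rule pair_wins[of b m])
    fix c c' assume c: "c \<in> {b, m}" "c' \<in> W" "allowed c c'"
    show "c' \<in> {b, m} \<or> wins_from c'"
    proof (cases "adj c c'")
      case True
      then have "c' \<in> N c" using c(2) by (simp add: N_def)
      then show ?thesis using c(1) m(2) \<open>N m = {b, m}\<close> by auto
    next
      case False
      then show ?thesis using c uncovered_wins by (auto simp: allowed_def)
    qed
  qed (use b mW in auto)
qed

lemma exit_nearby:
  assumes "r \<in> X - W" "w \<in> W"
  shows "\<exists>u\<in>X - W. \<exists>c\<in>W. adj u r \<and> adj u c"
proof (rule ccontr)
  assume no_exit: "\<not> ?thesis"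
  have "(step X)\<^sup>*\<^sup>* r w"
    using X_walkable assms W_subset by (auto simp: walkable_def)
  then have "w \<in> X - W \<and> adj w r"
  proof (induction rule: rtranclp_induct)
    case base
    then show ?case using assms by simp
  next
    case (step y z)
    have z: "z \<in> X" "adj y z" using step.hyps by (auto simp: step_def)
    have "z \<in> X - W" using no_exit step.IH z by blast
    moreover have "adj z r"
      using outside_small[of z y r] step.IH z \<open>z \<in> X - W\<close> assms(1) adj_sym[of y z] by auto
    ultimately show ?case by simp
  qed
  then show False using assms by simp
qed

text \<open>
  It remains to deal with a robber who starts outside \<open>W\<close>. One free cop walks to an exit \<open>c\<close> of his
  component and steps in, which drives him to \<open>W\<close>, where the team waits in formation.
\<close>
lemma dispersed_wins:
  assumes w: "w \<in> W"
  shows "wins_on X (length homes + 4)"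
proof -
  let ?T = "homes @ [w, w]"
  have wX: "w \<in> X" "set ?T \<subseteq> X" using w W_subset homes_in by auto
  have arrived: "cop_win X (?T @ hs) r" if "r \<in> W" "length hs = 2" "set hs \<subseteq> X" for hs r
    using all_bases_win[OF that(1)] that w W_subset step_refl[of r X]
    unfolding wins_from_def formation_def by blast
  have outside: "cop_win X (?T @ hs) r"
    if "r \<in> X - W" "u \<in> X - W" "adj u r" "c \<in> W" "adj u c" "length hs = 2" "set hs \<subseteq> X" for hs r u c
  proof -
    have near_u: "adj u z \<or> z \<in> W" if "r \<in> X - W" "adj u r" "step X r z" for r z
      using outside_small[of u r z] that \<open>u \<in> X - W\<close> by (auto simp: step_def)
    have cX: "c \<in> X" using that W_subset by blast
    have "(list_all2 (step X))\<^sup>*\<^sup>* hs [c, w]"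
      using wX cX that by (intro team_walk[OF X_walkable]) auto
    then show ?thesis
      using that(1,3,6,7)
    proof (induction arbitrary: r rule: converse_rtranclp_induct)
      case base
      \<comment> \<open>If the robber is at \<open>u\<close>, stepping there catches him; otherwise it forces him to move.\<close>
      have "list_all2 (step X) [c, w] [u, w]"
        using wX cX \<open>u \<in> X - W\<close> \<open>adj u c\<close> by (auto simp: step_def intro: adj_sym)
      then have "list_all2 (step X) (?T @ [c, w]) (?T @ [u, w])"
        by (rule list_all2_appendI[OF steps_stay[OF wX(2)]])
      then show ?case
      proof (rule move)
        fix r' assume r': "step X r r'"
        show "cop_win X (?T @ [u, w]) r'"
        proof (cases "adj u r'")
          case True
          then show ?thesis
            using cop_win_catch[of "?T @ [u, w]" X r' u] wX \<open>u \<in> X - W\<close> r' by (auto simp: step_def)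
        next
          case False
          then show ?thesis
            using near_u[OF base(1,2) r'] arrived[of r' "[u, w]"] wX \<open>u \<in> X - W\<close> by auto
        qed
      qed
    next
      case (step hs hs')
      have hs': "length hs' = 2" "set hs' \<subseteq> X"
        using steps_in[OF step.hyps(1)] list_all2_lengthD[OF step.hyps(1)] step.prems by auto
      have "list_all2 (local.step X) (?T @ hs) (?T @ hs')"
        using steps_stay[OF wX(2)] step.hyps(1) by (rule list_all2_appendI)
      then show ?case
      proof (rule move)
        fix r' assume r': "local.step X r r'"
        show "cop_win X (?T @ hs') r'"
        proof (cases "r' \<in> W")
          case True
          then show ?thesis using arrived hs' by blast
        next
          case False
          then show ?thesis
            using near_u[OF step.prems(1,2) r'] step.IH[of r'] r' hs' by (auto simp: step_def)
        qed
      qed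
    qed
  qed
  have "cop_win X (?T @ [w, w]) r" if "r \<in> X" for r
  proof (cases "r \<in> W")
    case True
    then show ?thesis using arrived[of r "[w, w]"] wX by simp
  next
    case False
    then obtain u c where "u \<in> X - W" "adj u r" "c \<in> W" "adj u c"
      using exit_nearby[of r w] \<open>r \<in> X\<close> w by blast
    then show ?thesis using outside[of r u c "[w, w]"] that False wX by simp
  qed
  then show ?thesis
    unfolding wins_on_def using wX by (intro exI[of _ "?T @ [w, w]"]) auto
qed

end

section \<open>Shrinking the territory\<close>

text \<open>
  Take a largest \<open>D\<close> such that the sets \<open>N v\<close> with \<open>v\<close> in \<open>D\<close> cover three times as many
  points as \<open>D\<close> has. A set \<open>N v\<close> with three uncovered points could be added.
\<close>
lemma greedy_cover:
  fixes N :: "'a \<Rightarrow> 'a set"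
  assumes W: "finite W" and N: "\<And>v. N v \<subseteq> W"
  obtains D where "D \<subseteq> W" "3 * card D \<le> card W" "\<And>v. v \<in> W \<Longrightarrow> card (N v - \<Union>(N ` D)) \<le> 2"
proof -
  define P where "P D \<longleftrightarrow> D \<subseteq> W \<and> 3 * card D \<le> card (\<Union>(N ` D))" for D
  have "P {}" by (simp add: P_def)
  moreover have "\<forall>D. P D \<longrightarrow> card D < Suc (card W)"
    using W by (auto simp: P_def card_mono less_Suc_eq_le)
  ultimately obtain D where D: "P D" "\<And>D'. P D' \<Longrightarrow> card D' \<le> card D"
    using ex_has_greatest_nat[of P "{}" card "Suc (card W)"] by blast
  have fin: "finite D" "finite (N v)" "finite (\<Union>(N ` D))" for v
    using D(1) W N by (auto simp: P_def intro: finite_subset)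
  have "card (N v - \<Union>(N ` D)) \<le> 2" if v: "v \<in> W" for v
  proof (rule ccontr)
    assume many: "\<not> card (N v - \<Union>(N ` D)) \<le> 2"
    have "v \<notin> D" using many by (auto simp: Diff_eq_empty_iff[THEN iffD2, OF UN_upper])
    have new: "\<Union>(N ` insert v D) = (N v - \<Union>(N ` D)) \<union> \<Union>(N ` D)" by auto
    have "card (\<Union>(N ` insert v D)) = card (N v - \<Union>(N ` D)) + card (\<Union>(N ` D))"
      unfolding new by (rule card_Un_disjoint) (use fin in auto)
    then have "P (insert v D)"
      using many D(1) v fin \<open>v \<notin> D\<close> by (simp add: P_def)
    then show False using D(2)[of "insert v D"] fin \<open>v \<notin> D\<close> by simp
  qed
  moreover have "card (\<Union>(N ` D)) \<le> card W"
    using W N by (intro card_mono) auto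
  ultimately show ?thesis using that[of D] D(1) by (auto simp: P_def)
qed

lemma card_three:
  assumes "finite B" "{a, b, c} \<subseteq> B" "a \<noteq> b" "b \<noteq> c" "a \<noteq> c"
  shows "3 \<le> card B"
  using card_mono[OF assms(1,2)] assms(3-) by simp

context closed_adjacency
begin

definition distance :: "'a set \<Rightarrow> 'a \<Rightarrow> 'a \<Rightarrow> nat" where
  "distance X u v = (LEAST n. (step X ^^ n) u v)"

definition geodesic :: "'a set \<Rightarrow> nat \<Rightarrow> (nat \<Rightarrow> 'a) \<Rightarrow> bool" where
  "geodesic X n p \<longleftrightarrow> p 0 \<in> X \<and> (\<forall>i<n. step X (p i) (p (Suc i))) \<and> distance X (p 0) (p n) = n"

lemma distance_walk: "walkable X \<Longrightarrow> u \<in> X \<Longrightarrow> v \<in> X \<Longrightarrow> (step X ^^ distance X u v) u v"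
  unfolding distance_def walkable_def by (rule LeastI_ex) (simp add: rtranclp_power[symmetric])

lemma distance_le: "(step X ^^ n) u v \<Longrightarrow> distance X u v \<le> n"
  unfolding distance_def by (rule Least_le)

lemma distance_step: "walkable X \<Longrightarrow> u \<in> X \<Longrightarrow> v \<in> X \<Longrightarrow> w \<in> X \<Longrightarrow> adj v w \<Longrightarrow>
    distance X u w \<le> Suc (distance X u v)"
  by (rule distance_le) (auto simp: step_def intro!: relcomppI distance_walk)

lemma walk_pad:
  assumes "(step X ^^ n) u v" "n \<le> k" "v \<in> X"
  shows "(step X ^^ k) u v"
  using assms(2)
proof (induction rule: dec_induct)
  case (step k)
  then show ?case using step_refl[OF assms(3)] by auto
qed (use assms(1) in simp)

lemma walk3: "(step X ^^ 3) u v \<Longrightarrow> \<exists>y\<in>X. adj u y \<and> within2 X y v"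
  unfolding numeral_3_eq_3 within2_def by (auto simp: step_def) blast

lemma walk2: "(step X ^^ 2) u v \<Longrightarrow> within2 X u v"
  unfolding numeral_2_eq_2 within2_def by (auto simp: step_def)

lemma geodesic_in: "geodesic X n p \<Longrightarrow> i \<le> n \<Longrightarrow> p i \<in> X"
  unfolding geodesic_def by (cases i) (auto simp: step_def)

lemma geodesic_distance:
  assumes "walkable X" and p: "geodesic X n p" and i: "i \<le> n"
  shows "distance X (p 0) (p i) = i"
proof -
  have steps: "(step X ^^ k) (p j) (p (j + k))" if "j + k \<le> n" for j k
    using that p unfolding relpowp_fun_conv geodesic_def
    by (intro exI[of _ "\<lambda>i. p (j + i)"]) auto
  have "distance X (p 0) (p i) \<le> i"
    using steps[of 0 i] i by (intro distance_le) simp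
  moreover have "(step X ^^ (distance X (p 0) (p i) + (n - i))) (p 0) (p n)"
    unfolding relpowp_add
    using steps[of i "n - i"] distance_walk[OF assms(1), of "p 0" "p i"] geodesic_in[OF p] i
    by (intro relcomppI) simp_all
  then have "n \<le> distance X (p 0) (p i) + (n - i)"
    using distance_le p unfolding geodesic_def by metis
  ultimately show ?thesis using i by linarith
qed

lemma geodesic_exists:
  assumes "walkable X" "u \<in> X" "v \<in> X"
  obtains p where "geodesic X (distance X u v) p" "p 0 = u" "p (distance X u v) = v"
  using distance_walk[OF assms] assms(2) unfolding relpowp_fun_conv geodesic_def by metis

lemma star_guard:
  assumes "walkable X" "v \<in> X"
    and "\<And>r. r \<in> X - {w. adj v w} \<Longrightarrow> wins_on (component (X - {w. adj v w}) r) m"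
  shows "wins_on X (Suc m)"
  by (rule guard_reduction[where p = "\<lambda>_. v" and g = "\<lambda>_. 0" and n = 0 and S = "{w. adj v w}",
      OF assms(1) _ _ _ _ _ assms(3)]) (use assms(2) in auto)

text \<open>
  The shadow of a robber at distance \<open>d\<close> from the start of the geodesic is the \<open>d\<close>-th vertex of the
  geodesic, or its end if \<open>d\<close> is too large. Vertices of the geodesic are their own shadows.
\<close>
lemma geodesic_guard:
  assumes X: "walkable X" and p: "geodesic X n p"
    and wins: "\<And>r. r \<in> X - p ` {..n} \<Longrightarrow> wins_on (component (X - p ` {..n}) r) m"
  shows "wins_on X (Suc m)"
proof (rule guard_reduction[OF X, where n = n and p = p and g = "\<lambda>x. min (distance X (p 0) x) n", OF _ _ _ _ _ wins])
  have p0: "p 0 \<in> X" using geodesic_in[OF p] by simp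
  have adj_p: "adj (p i) (p (Suc i))" if "i < n" for i
    using p that by (auto simp: geodesic_def step_def)
  show "p i \<in> X" if "i \<le> n" for i using geodesic_in[OF p that] .
  show "adj (p i) (p (Suc i))" if "i < n" for i using adj_p that .
  show "min (distance X (p 0) y) n \<le> Suc (min (distance X (p 0) x) n)" if "x \<in> X" "y \<in> X" "adj x y" for x y
    using distance_step[OF X p0 that] by auto
  show "adj (p (min (distance X (p 0) x) n)) s"
    if "x \<in> X" "s \<in> X" "s \<in> p ` {..n}" "adj x s" for x s
  proof -
    obtain i where i: "i \<le> n" "s = p i" using \<open>s \<in> p ` {..n}\<close> by auto
    have "distance X (p 0) s = i" using geodesic_distance[OF X p] i by simp
    then have "i \<le> Suc (distance X (p 0) x)" "distance X (p 0) x \<le> Suc i"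
      using distance_step[OF X p0] that adj_sym by metis+
    then consider "min (distance X (p 0) x) n = i" | "Suc (min (distance X (p 0) x) n) = i"
      | "min (distance X (p 0) x) n = Suc i" "i < n"
      using i(1) by linarith
    then show ?thesis
    proof cases
      case 1 then show ?thesis using i by simp
    next
      case 2
      then have "min (distance X (p 0) x) n < n" using i(1) by linarith
      then show ?thesis using adj_p[of "min (distance X (p 0) x) n"] 2 i(2) by simp
    next
      case 3 then show ?thesis using i adj_p[of i] adj_sym by simp
    qed
  qed
qed auto

lemma adjacent_to_all:
  assumes X: "walkable X" and v: "v \<in> X"
    and small: "\<And>a b c. a \<in> X \<Longrightarrow> b \<in> X \<Longrightarrow> c \<in> X \<Longrightarrow> adj a b \<Longrightarrow> adj b c \<Longrightarrow> a = b \<or> b = c \<or> a = c"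
    and x: "x \<in> X"
  shows "adj v x"
proof -
  have "(step X)\<^sup>*\<^sup>* v x" using X v x by (auto simp: walkable_def)
  then show ?thesis
  proof (induction rule: rtranclp_induct)
    case (step y z)
    then show ?case using small[of v y z] v adj_refl[of v] unfolding step_def[of X y z] by blast
  qed simp
qed

text \<open>
  When neither stars nor geodesics contain three vertices of \<open>U\<close>, the territory is dispersed. The
  bound \<open>3 * m + 2\<close> leaves room for the rounding in the final bound: \<open>m\<close> homes are affordable as
  every home covers three vertices of its own.
\<close>
lemma no_guard_wins:
  assumes X: "finite X" "walkable X"
    and small: "\<And>a b c. a \<in> X - U \<Longrightarrow> b \<in> X - U \<Longrightarrow> c \<in> X - U \<Longrightarrow> adj a b \<Longrightarrow> adj b c \<Longrightarrow>
      a = b \<or> b = c \<or> a = c"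
    and m: "card (U \<inter> X) \<le> 3 * m + 2"
    and no_star: "\<And>v. v \<in> X \<Longrightarrow> card {w \<in> U \<inter> X. adj v w} \<le> 2"
    and no_path: "\<And>n p. geodesic X n p \<Longrightarrow> card (U \<inter> p ` {..n}) \<le> 2"
  shows "wins_on X (m + 4)"
proof (cases "U \<inter> X = {}")
  case True
  then have X_U: "X - U = X" by blast
  obtain v where v: "v \<in> X" using X(2) by (auto simp: walkable_def)
  have "cop_win X (replicate (m + 4) v) r" if "r \<in> X" for r
    using cop_win_catch[of "replicate (m + 4) v" X r v] v that
      adjacent_to_all[OF X(2) v small[unfolded X_U] that] by auto
  then show ?thesis
    unfolding wins_on_def using v by (intro exI[of _ "replicate (m + 4) v"]) auto
next
  case False
  define W where "W = U \<inter> X"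
  obtain w where w: "w \<in> W" using False by (auto simp: W_def)
  have W: "finite W" "W \<subseteq> X" "X - W = X - U" using X(1) by (auto simp: W_def)
  define N where "N v = {w \<in> W. within2 X v w}" for v
  have N_sub: "N v \<subseteq> W" for v by (auto simp: N_def)
  obtain D where D: "D \<subseteq> W" "3 * card D \<le> card W" "\<And>v. v \<in> W \<Longrightarrow> card (N v - \<Union>(N ` D)) \<le> 2"
    using greedy_cover[of W N, OF W(1) N_sub] by blast
  obtain ds where ds: "set ds = D" "length ds = card D"
    using finite_subset[OF D(1) W(1)] finite_distinct_list distinct_card by metis
  have "length ds \<le> m" using D(2) ds m by (simp add: W_def)
  \<comment> \<open>Spare cops share the home \<open>w\<close>.\<close>
  define homes where "homes = ds @ replicate (m - length ds) w"
  have homes: "length homes = m" "D \<subseteq> set homes" "set homes \<subseteq> W"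
    using \<open>length ds \<le> m\<close> ds(1) D(1) w by (auto simp: homes_def)
  interpret dispersed_territory adj X W homes
  proof
    show "walkable X" "W \<subseteq> X" "finite W" "set homes \<subseteq> W" by fact+
    show "card {w \<in> W. adj v w} \<le> 2" if "v \<in> X" for v
      using no_star[OF that] by (simp add: W_def)
    show "a = b \<or> b = c \<or> a = c"
      if "a \<in> X - W" "b \<in> X - W" "c \<in> X - W" "adj a b" "adj b c" for a b c
      using small that W(3) by blast
    show "\<exists>y\<in>X. adj v y \<and> within2 X y w" if vw: "v \<in> W" "w \<in> W" for v w
    proof -
      let ?n = "distance X v w"
      have vX: "v \<in> X" "w \<in> X" using vw W(2) by auto
      obtain p where p: "geodesic X ?n p" "p 0 = v" "p ?n = w"
        using geodesic_exists[OF X(2) vX] by blast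
      have p_inj: "p i \<noteq> p j" if "i < j" "j \<le> ?n" for i j
        using geodesic_distance[OF X(2) p(1)] that by (metis less_imp_le_nat less_le_trans nat_neq_iff)
      have inner: "p i \<in> X - U" if "0 < i" "i < ?n" for i
      proof -
        have "p i \<notin> U"
        proof
          assume "p i \<in> U"
          moreover have "p 0 \<in> U" "p ?n \<in> U"
            using p(2,3) vw by (simp_all add: W_def)
          ultimately have "{p 0, p i, p ?n} \<subseteq> U \<inter> p ` {..?n}"
            using that by auto
          then have "3 \<le> card (U \<inter> p ` {..?n})"
            using p_inj[of 0 i] p_inj[of i ?n] p_inj[of 0 ?n] that
            by (intro card_three[of _ "p 0" "p i" "p ?n"]) auto
          then show False using no_path[OF p(1)] by simp
        qed
        then show ?thesis using geodesic_in[OF p(1)] that by auto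
      qed
      have adj_p: "adj (p i) (p (Suc i))" if "i < ?n" for i
        using p(1) that by (auto simp: geodesic_def step_def)
      \<comment> \<open>Otherwise \<open>p 1\<close>, \<open>p 2\<close>, \<open>p 3\<close> would be a path outside \<open>W\<close>.\<close>
      have "?n \<le> 3"
      proof (rule ccontr)
        assume "\<not> ?n \<le> 3"
        then show False
          using small[of "p 1" "p 2" "p 3"] inner[of 1] inner[of 2] inner[of 3] adj_p[of 1] adj_p[of 2]
            p_inj[of 1 2] p_inj[of 2 3] p_inj[of 1 3] by (auto simp: numeral_2_eq_2 numeral_3_eq_3)
      qed
      then show ?thesis
        using walk3 walk_pad[OF distance_walk[OF X(2) vX]] vX by blast
    qed
    show "within2 X u z" if uvz: "u \<in> W" "v \<in> W" "z \<in> W" "within2 X u v" "adj v z" for u v z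
    proof (rule ccontr)
      assume far: "\<not> within2 X u z"
      have inX: "u \<in> X" "v \<in> X" "z \<in> X" using uvz W(2) by auto
      obtain y where y: "y \<in> X" "adj u y" "adj y v" using uvz(4) by (auto simp: within2_def)
      \<comment> \<open>Otherwise this walk would be a geodesic with three vertices in \<open>W\<close>.\<close>
      define p where "p i = [u, y, v, z] ! i" for i :: nat
      have p: "p 0 = u" "p 1 = y" "p 2 = v" "p 3 = z" by (simp_all add: p_def)
      have steps: "step X (p i) (p (Suc i))" if "i < 3" for i
        using that y uvz(5) inX by (auto simp: step_def p_def less_Suc_eq numeral_3_eq_3)
      have "(step X ^^ 3) u z"
        unfolding relpowp_fun_conv using steps p by (intro exI[of _ p]) auto
      then have "distance X u z \<le> 3" by (rule distance_le)
      moreover have "\<not> distance X u z \<le> 2"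
        using far walk2 walk_pad[OF distance_walk[OF X(2) inX(1,3)]] inX(3) by blast
      ultimately have "geodesic X 3 p"
        using steps p inX by (auto simp: geodesic_def)
      then have "card (U \<inter> p ` {..3}) \<le> 2" by (rule no_path)
      moreover have "{p 0, p 2, p 3} \<subseteq> U \<inter> p ` {..3}"
        using uvz p by (auto simp: W_def)
      moreover have "u \<noteq> v" "v \<noteq> z" "u \<noteq> z"
        using far uvz(4,5) inX adj_within2 by auto
      ultimately show False
        using card_three[of "U \<inter> p ` {..3}" "p 0" "p 2" "p 3"] p by auto
    qed
    show "card {w \<in> W. within2 X v w \<and> (\<forall>h\<in>set homes. \<not> within2 X h w)} \<le> 2" if "v \<in> W" for v
    proof -
      have "{w \<in> W. within2 X v w \<and> (\<forall>h\<in>set homes. \<not> within2 X h w)} \<subseteq> N v - \<Union>(N ` D)"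
        using homes(2) by (auto simp: N_def)
      then have "card {w \<in> W. within2 X v w \<and> (\<forall>h\<in>set homes. \<not> within2 X h w)} \<le> card (N v - \<Union>(N ` D))"
        using W(1) by (intro card_mono) (auto simp: N_def)
      then show ?thesis using D(3)[OF that] by simp
    qed
  qed
  show ?thesis using dispersed_wins[OF w] homes(1) by simp
qed

lemma guarded_part_small:
  assumes "finite X" "card (U \<inter> X) \<le> 3 * m + 2" "3 \<le> card (U \<inter> X \<inter> S)" "Y \<subseteq> X - S"
  shows "0 < m" "card (U \<inter> Y) \<le> 3 * (m - 1) + 2"
proof -
  have "card (U \<inter> X \<inter> S) + card (U \<inter> Y) \<le> card (U \<inter> X)"
    using assms(1,4) by (subst card_Un_disjoint[symmetric]) (auto intro: card_mono finite_subset)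
  then show "0 < m" "card (U \<inter> Y) \<le> 3 * (m - 1) + 2"
    using assms(2,3) by auto
qed

text \<open>
  Every guard removes three vertices of \<open>U\<close> from the territory and hence lowers \<open>m\<close> by one.
\<close>
lemma wins_bound:
  assumes "finite X" "walkable X"
    and "\<And>a b c. a \<in> X - U \<Longrightarrow> b \<in> X - U \<Longrightarrow> c \<in> X - U \<Longrightarrow> adj a b \<Longrightarrow> adj b c \<Longrightarrow>
      a = b \<or> b = c \<or> a = c"
    and "card (U \<inter> X) \<le> 3 * m + 2"
  shows "wins_on X (m + 4)"
  using assms
proof (induction m arbitrary: X rule: less_induct)
  case (less m)
  have rest: "wins_on (component (X - S) r) (m - 1 + 4)"
    if S: "3 \<le> card (U \<inter> X \<inter> S)" and r: "r \<in> X - S" for S r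
  proof -
    have Y: "component (X - S) r \<subseteq> X - S" using component_subset[OF r] .
    show ?thesis
      using guarded_part_small[OF less.prems(1,4) S Y] component_walkable[OF r] Y
      by (intro less.IH less.prems(3)) (auto intro: finite_subset[OF _ less.prems(1)])
  qed
  have pred: "0 < m" if "3 \<le> card (U \<inter> X \<inter> S)" for S
    using guarded_part_small(1)[OF less.prems(1,4) that, of "{}"] by simp
  show ?case
  proof (cases "\<exists>S. 3 \<le> card (U \<inter> X \<inter> S) \<and>
      ((\<exists>v\<in>X. S = {w. adj v w}) \<or> (\<exists>n p. geodesic X n p \<and> S = p ` {..n}))")
    case True
    then obtain S where S: "3 \<le> card (U \<inter> X \<inter> S)"
      "(\<exists>v\<in>X. S = {w. adj v w}) \<or> (\<exists>n p. geodesic X n p \<and> S = p ` {..n})" by blast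
    have "wins_on X (Suc (m - 1 + 4))"
      using S(2) star_guard[OF less.prems(2)] geodesic_guard[OF less.prems(2)] rest[OF S(1)] by metis
    then show ?thesis using pred[OF S(1)] by (simp add: add.commute)
  next
    case False
    show ?thesis
    proof (rule no_guard_wins[OF less.prems])
      fix v assume "v \<in> X"
      then have "\<not> 3 \<le> card (U \<inter> X \<inter> {w. adj v w})" using False by blast
      moreover have "U \<inter> X \<inter> {w. adj v w} = {w \<in> U \<inter> X. adj v w}" by blast
      ultimately show "card {w \<in> U \<inter> X. adj v w} \<le> 2" by simp
    next
      fix n p assume p: "geodesic X n p"
      then have "\<not> 3 \<le> card (U \<inter> X \<inter> p ` {..n})" using False by blast
      moreover have "U \<inter> X \<inter> p ` {..n} = U \<inter> p ` {..n}" using geodesic_in[OF p] by auto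
      ultimately show "card (U \<inter> p ` {..n}) \<le> 2" by simp
    qed
  qed
qed

end

section \<open>Cop strategies and components of digraphs\<close>

context closed_adjacency
begin

text \<open>
  The cops are to move: \<open>\<sigma> []\<close> is their present placement, and histories begin with the robber's
  present position \<open>r\<close>.
\<close>
definition winning_strategy :: "'a set \<Rightarrow> 'a list \<Rightarrow> 'a \<Rightarrow> ('a list \<Rightarrow> 'a list) \<Rightarrow> bool" where
  "winning_strategy X cs r \<sigma> \<longleftrightarrow> \<sigma> [] = cs \<and>
    (\<forall>\<rho>. \<rho> 0 = r \<longrightarrow> (\<forall>n. step X (\<rho> n) (\<rho> (Suc n))) \<longrightarrow>
      (\<forall>n. list_all2 (step X) (cops_at \<sigma> \<rho> n) (cops_at \<sigma> \<rho> (Suc n))) \<and> captured \<sigma> \<rho>)"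

lemma winning_strategyI:
  assumes "\<sigma> [] = cs"
    and "\<And>\<rho> n. \<rho> 0 = r \<Longrightarrow> \<forall>n. step X (\<rho> n) (\<rho> (Suc n)) \<Longrightarrow>
      list_all2 (step X) (cops_at \<sigma> \<rho> n) (cops_at \<sigma> \<rho> (Suc n))"
    and "\<And>\<rho>. \<rho> 0 = r \<Longrightarrow> \<forall>n. step X (\<rho> n) (\<rho> (Suc n)) \<Longrightarrow> captured \<sigma> \<rho>"
  shows "winning_strategy X cs r \<sigma>"
  using assms by (simp add: winning_strategy_def)

lemma winning_strategyD:
  assumes "winning_strategy X cs r \<sigma>"
  shows "\<sigma> [] = cs"
    and "\<rho> 0 = r \<Longrightarrow> \<forall>n. step X (\<rho> n) (\<rho> (Suc n)) \<Longrightarrow>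
      list_all2 (step X) (cops_at \<sigma> \<rho> n) (cops_at \<sigma> \<rho> (Suc n))"
    and "\<rho> 0 = r \<Longrightarrow> \<forall>n. step X (\<rho> n) (\<rho> (Suc n)) \<Longrightarrow> captured \<sigma> \<rho>"
  using assms by (simp_all add: winning_strategy_def)

text \<open>
  After the first move of the cops, the strategy looks at the reply \<open>r'\<close> of the robber and switches to
  the strategy for the position reached.
\<close>
lemma cop_win_strategy:
  assumes "cop_win X cs r"
  shows "\<exists>\<sigma>. winning_strategy X cs r \<sigma>"
  using assms
proof (induction rule: cop_win.induct)
  case (catch cs cs' r)
  define \<sigma> where "\<sigma> h = (if h = [] then cs else cs')" for h :: "'a list"
  have at: "cops_at \<sigma> \<rho> 0 = cs" "cops_at \<sigma> \<rho> (Suc n) = cs'" for \<rho> n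
    by (simp_all add: cops_at_def \<sigma>_def)
  have "winning_strategy X cs r \<sigma>"
  proof (rule winning_strategyI)
    fix \<rho> :: "nat \<Rightarrow> 'a" and n
    assume \<rho>: "\<rho> 0 = r"
    show "list_all2 (step X) (cops_at \<sigma> \<rho> n) (cops_at \<sigma> \<rho> (Suc n))"
      using catch(1) steps_stay[OF steps_in[OF catch(1)]] by (cases n) (simp_all add: at)
    show "captured \<sigma> \<rho>"
      unfolding captured_def using \<rho> catch(2) at(2)[of \<rho> 0] by (intro exI[of _ 0]) simp
  qed (simp add: \<sigma>_def)
  then show ?case by blast
next
  case (move cs cs' r)
  have "\<forall>r'\<in>{r'. step X r r'}. \<exists>\<tau>. winning_strategy X cs' r' \<tau>"
    using move.IH by blast
  from bchoice[OF this] obtain \<tau> where \<tau>: "\<And>r'. step X r r' \<Longrightarrow> winning_strategy X cs' r' (\<tau> r')"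
    by blast
  define \<sigma> where "\<sigma> h = (case h of [] \<Rightarrow> cs | [_] \<Rightarrow> cs' | _ # r' # h' \<Rightarrow> \<tau> r' (r' # h'))" for h
  have upt: "map \<rho> [0..<Suc n] = \<rho> 0 # map (\<rho> \<circ> Suc) [0..<n]" for \<rho> :: "nat \<Rightarrow> 'a" and n
    by (simp add: upt_conv_Cons map_Suc_upt[symmetric] del: upt_Suc)
  have at: "cops_at \<sigma> \<rho> 0 = cs" "cops_at \<sigma> \<rho> (Suc 0) = cs'"
    "cops_at \<sigma> \<rho> (Suc (Suc n)) = cops_at (\<tau> (\<rho> 1)) (\<rho> \<circ> Suc) (Suc n)" for \<rho> n
    unfolding cops_at_def upt by (simp_all add: \<sigma>_def)
  have "winning_strategy X cs r \<sigma>"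
  proof (rule winning_strategyI)
    fix \<rho> :: "nat \<Rightarrow> 'a" and n
    assume \<rho>: "\<rho> 0 = r" "\<forall>n. step X (\<rho> n) (\<rho> (Suc n))"
    have first: "step X r (\<rho> 1)" using \<rho>(2)[rule_format, of 0] \<rho>(1) by simp
    have "(\<rho> \<circ> Suc) 0 = \<rho> 1" "\<forall>n. step X ((\<rho> \<circ> Suc) n) ((\<rho> \<circ> Suc) (Suc n))"
      using \<rho>(2) by simp_all
    note later = winning_strategyD(1)[OF \<tau>[OF first]] winning_strategyD(2,3)[OF \<tau>[OF first] this]
    have shift: "cops_at \<sigma> \<rho> (Suc n) = cops_at (\<tau> (\<rho> 1)) (\<rho> \<circ> Suc) n" for n
      using later(1) at(2,3)[of \<rho>] by (cases n) (simp_all add: cops_at_def)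
    show "list_all2 (step X) (cops_at \<sigma> \<rho> n) (cops_at \<sigma> \<rho> (Suc n))"
    proof (cases n)
      case 0
      then show ?thesis using move.hyps(1) at by simp
    next
      case (Suc k)
      then show ?thesis using later(2)[of k] by (simp only: shift)
    qed
    obtain n where "(\<rho> \<circ> Suc) n \<in> set (cops_at (\<tau> (\<rho> 1)) (\<rho> \<circ> Suc) n) \<or>
        (\<rho> \<circ> Suc) n \<in> set (cops_at (\<tau> (\<rho> 1)) (\<rho> \<circ> Suc) (Suc n))"
      using later(3) unfolding captured_def by blast
    then show "captured \<sigma> \<rho>"
      unfolding captured_def by (intro exI[of _ "Suc n"]) (simp add: shift)
  qed (simp add: \<sigma>_def)
  then show ?case by blast
qed

end

lemma closed_adjacency_graph:
  assumes "graph G"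
  shows "closed_adjacency (\<lambda>u v. u = v \<or> u \<rightarrow>\<^bsub>G\<^esub> v)"
proof -
  interpret graph G by fact
  show ?thesis by unfold_locales (auto intro: graph_symmetric)
qed

lemma cops_win_if_wins_on:
  assumes G: "graph G"
    and wins: "closed_adjacency.wins_on (\<lambda>u v. u = v \<or> u \<rightarrow>\<^bsub>G\<^esub> v) (verts G) k"
  shows "cops_win G k"
proof -
  interpret graph G by fact
  interpret C: closed_adjacency "\<lambda>u v. u = v \<or> u \<rightarrow>\<^bsub>G\<^esub> v"
    by (rule closed_adjacency_graph[OF G])
  have step: "step_or_stay G = C.step (verts G)"
    by (auto simp: fun_eq_iff step_or_stay_def C.step_def adj_in_verts)
  obtain cs where cs: "length cs = k" "set cs \<subseteq> verts G" "\<And>r. r \<in> verts G \<Longrightarrow> C.cop_win (verts G) cs r"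
    using wins unfolding C.wins_on_def by blast
  have "\<forall>r\<in>verts G. \<exists>\<tau>. C.winning_strategy (verts G) cs r \<tau>"
    using C.cop_win_strategy[OF cs(3)] by blast
  from bchoice[OF this] obtain \<tau> where
    \<tau>: "\<And>r. r \<in> verts G \<Longrightarrow> C.winning_strategy (verts G) cs r (\<tau> r)"
    by blast
  define \<sigma> where "\<sigma> h = (if h = [] then cs else \<tau> (hd h) h)" for h
  have at: "cops_at \<sigma> \<rho> n = cops_at (\<tau> (\<rho> 0)) \<rho> n" if "\<rho> 0 \<in> verts G" for \<rho> n
    using C.winning_strategyD(1)[OF \<tau>[OF that]] by (simp add: cops_at_def \<sigma>_def hd_map)
  have "list_all2 (step_or_stay G) (cops_at \<sigma> \<rho> n) (cops_at \<sigma> \<rho> (Suc n))" "captured \<sigma> \<rho>"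
    if "robber_play G \<rho>" for \<rho> n
  proof -
    have \<rho>: "\<rho> 0 \<in> verts G" "\<forall>n. C.step (verts G) (\<rho> n) (\<rho> (Suc n))"
      using that by (simp_all add: robber_play_def step)
    show "list_all2 (step_or_stay G) (cops_at \<sigma> \<rho> n) (cops_at \<sigma> \<rho> (Suc n))"
      unfolding at[of \<rho>, OF \<rho>(1)] step by (rule C.winning_strategyD(2)[OF \<tau>[OF \<rho>(1)] refl \<rho>(2)])
    show "captured \<sigma> \<rho>"
      using C.winning_strategyD(3)[OF \<tau>[OF \<rho>(1)] refl \<rho>(2)]
      by (simp add: captured_def at[of \<rho>, OF \<rho>(1)])
  qed
  moreover have "\<sigma> [] = cs" by (simp add: \<sigma>_def)
  ultimately show ?thesis
    unfolding cops_win_def cop_strategy_def using cs(1,2) by (intro exI[of _ \<sigma>]) simp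
qed

text \<open>
  A component is a maximal connected subgraph, so it suffices to take a connected extension with as
  many vertices and arcs as possible.
\<close>
lemma connected_subgraph_extends_to_component:
  assumes "fin_digraph G" "subgraph H G" "connected H"
  obtains K where "K \<in> components G" "verts H \<subseteq> verts K"
proof -
  interpret fin_digraph G by fact
  define P where "P K \<longleftrightarrow> subgraph K G \<and> connected K \<and> subgraph H K" for K
  have "P H" using assms by (auto simp: P_def intro: wf_digraph.subgraph_refl)
  moreover have bound: "card (verts K) + card (arcs K) \<le> card (verts G) + card (arcs G)" if "P K" for K
    using that by (auto simp: P_def intro!: add_mono card_mono)
  ultimately obtain K where K: "P K"
    and max: "\<And>K'. P K' \<Longrightarrow> card (verts K') + card (arcs K') \<le> card (verts K) + card (arcs K)"
    using ex_has_greatest_nat[of P H "\<lambda>K. card (verts K) + card (arcs K)"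
        "Suc (card (verts G) + card (arcs G))"]
    by (auto simp: less_Suc_eq_le)
  have "K' = K" if K': "subgraph K K'" "subgraph K' G" "connected K'" for K'
  proof -
    have "P K'" using K K' by (auto simp: P_def intro: subgraph_trans)
    then have le: "card (verts K') + card (arcs K') \<le> card (verts K) + card (arcs K)" by (rule max)
    have fin: "finite (verts K')" "finite (arcs K')"
      using fin_digraph.finite_verts fin_digraph.finite_arcs fin_digraph_subgraph[OF K'(2)] by blast+
    have sub: "verts K \<subseteq> verts K'" "arcs K \<subseteq> arcs K'" using K'(1) by auto
    then have "card (verts K') \<le> card (verts K)" "card (arcs K') \<le> card (arcs K)"
      using le card_mono[OF fin(1) sub(1)] card_mono[OF fin(2) sub(2)] by linarith+
    then have "verts K = verts K'" "arcs K = arcs K'"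
      using card_seteq[OF fin(1) sub(1)] card_seteq[OF fin(2) sub(2)] by blast+
    then show ?thesis
      using K'(1) by (auto simp: subgraph_def compatible_def)
  qed
  then have "max_subgraph connected K"
    using K by (auto simp: P_def max_subgraph_def)
  then show ?thesis
    using that[of K] K by (auto simp: components_def P_def)
qed

text \<open>
  Three vertices in a row outside \<open>U\<close> would induce a connected subgraph, and hence lie in a single
  component.
\<close>
lemma separator_outside_small:
  assumes G: "graph G" and U: "component_order_separator 2 G U"
    and abc: "a \<in> verts G - U" "b \<in> verts G - U" "c \<in> verts G - U" "a \<rightarrow>\<^bsub>G\<^esub> b" "b \<rightarrow>\<^bsub>G\<^esub> c"
  shows "a = b \<or> b = c \<or> a = c"
proof (rule ccontr)
  assume distinct: "\<not> ?thesis"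
  interpret graph G by fact
  let ?F = "G \<restriction> (verts G - U)" and ?H = "G \<restriction> {a, b, c}"
  interpret F: fin_digraph ?F
    by (rule fin_digraph_subgraph) (simp add: subgraph_induce_subgraphI)
  interpret H: wf_digraph ?H by (rule wellformed_induce_subgraph)
  have sub: "subgraph ?H ?F"
    using abc(1-3) by (intro subgraphI) (auto simp: compatible_def intro: F.wf_digraph)
  have "a \<rightarrow>\<^bsub>?H\<^esub> b" "b \<rightarrow>\<^bsub>?H\<^esub> c" "b \<rightarrow>\<^bsub>?H\<^esub> a" "c \<rightarrow>\<^bsub>?H\<^esub> b"
    using abc(4,5) graph_symmetric[OF abc(4)] graph_symmetric[OF abc(5)]
    by (auto simp: arcs_ends_conv)
  then have "a \<rightarrow>\<^sup>*\<^bsub>?H\<^esub> b" "b \<rightarrow>\<^sup>*\<^bsub>?H\<^esub> c" "b \<rightarrow>\<^sup>*\<^bsub>?H\<^esub> a" "c \<rightarrow>\<^sup>*\<^bsub>?H\<^esub> b"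
    by (simp_all add: H.reachable_adjI)
  then have "u \<rightarrow>\<^sup>*\<^bsub>?H\<^esub> v" if "u \<in> {a, b, c}" "v \<in> {a, b, c}" for u v
    using that H.reachable_trans[of a b c] H.reachable_trans[of c b a] by auto
  then have "connected ?H"
    by (intro H.connectedI) (auto intro: H.reachable_mk_symmetricI)
  then obtain K where K: "K \<in> components ?F" "verts ?H \<subseteq> verts K"
    using connected_subgraph_extends_to_component[OF F.fin_digraph sub] by blast
  have "finite (verts K)"
    using K(1) F.finite_verts
    by (auto simp: components_def pre_digraph.max_subgraph_def dest!: subgraph_imp_subverts intro: finite_subset)
  then have "3 \<le> card (verts K)"
    using card_three[of "verts K" a b c] K(2) distinct by auto
  then show False
    using U K(1) by (auto simp: component_order_separator_def)
qed

theorem theorem1: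
  fixes G :: "('a, 'b) pre_digraph"
  assumes "graph G"
    and "connected G"
  shows "real (cop_number G) \<le> real (coc 2 G) / 3 + 4"
proof -
  interpret graph G by fact
  let ?adj = "\<lambda>u v. u = v \<or> u \<rightarrow>\<^bsub>G\<^esub> v"
  interpret C: closed_adjacency ?adj
    by (rule closed_adjacency_graph) fact
  obtain U where U: "component_order_separator 2 G U" "card U = coc 2 G"
    using component_order_separator_coc[OF assms(1)] by blast
  have "finite U"
    using U(1) finite_subset[OF _ finite_verts] by (auto simp: component_order_separator_def)
  define m where "m = coc 2 G div 3"
  have "strongly_connected G"
    using symmetric_connected_imp_strongly_connected[OF sym_arcs assms(2)] .
  then have "C.walkable (verts G)"
  proof -
    have "(C.step (verts G))\<^sup>*\<^sup>* u v" if "u \<rightarrow>\<^sup>*\<^bsub>G\<^esub> v" for u v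
      using that
    proof (induction rule: reachable_induct)
      case (step x y)
      then have "C.step (verts G) x y"
        using adj_in_verts by (auto simp: C.step_def)
      then show ?case using step.IH by simp
    qed simp
    then show ?thesis
      using \<open>strongly_connected G\<close> by (auto simp: C.walkable_def strongly_connected_def)
  qed
  moreover have "a = b \<or> b = c \<or> a = c"
    if "a \<in> verts G - U" "b \<in> verts G - U" "c \<in> verts G - U" "?adj a b" "?adj b c" for a b c
    using separator_outside_small[OF assms(1) U(1) that(1-3)] that(4,5) by blast
  moreover have "card (U \<inter> verts G) \<le> 3 * m + 2"
    using card_mono[OF \<open>finite U\<close>, of "U \<inter> verts G"] U(2) by (simp add: m_def)
  ultimately have "C.wins_on (verts G) (m + 4)"
    by (intro C.wins_bound[OF finite_verts])
  then have "cops_win G (m + 4)"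
    by (rule cops_win_if_wins_on[OF assms(1)])
  then have "cop_number G \<le> m + 4"
    unfolding cop_number_def by (rule Least_le)
  then show ?thesis
    by (simp add: m_def)
qed

end
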